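(* Let $p>3$ be a prime and let $G$ be an abelian group of order dividing $p^5$. Then \[ J_2(G)\cong \begin{cases} \mathbb{Z}_{p^5} & \text{if } G\cong G_1,\\ \mathbb{Z}_{p^3}\oplus\mathbb{Z}_{p^2}^{(3)} & \text{if } G\cong G_{13},\\ \mathbb{Z}_{p^4}\oplus\mathbb{Z}_{p}^{(3)} & \text{if } G\cong G_{26},\\ \mathbb{Z}_{p^2}^{(4)}\oplus\mathbb{Z}_{p}^{(5)} & \text{if } G\cong G_{43},\\ \mathbb{Z}_{p^3}\oplus\mathbb{Z}_{p}^{(8)} & \text{if } G\cong G_{51},\\ \mathbb{Z}_{p^2}\oplus\mathbb{Z}_{p}^{(15)} & \text{if } G\cong G_{66},\\ \mathbb{Z}_{p}^{(25)} & \text{if } G\cong G_{70}. \end{cases} \]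
   Context: Notation: $\mathbb{Z}_n$ is the cyclic group of order $n$, and $A^{(n)}$ is the direct sum of $n$ copies of $A$. The groups are $G_1\cong\mathbb{Z}_{p^5}$, $G_{13}\cong\mathbb{Z}_{p^3}\times\mathbb{Z}_{p^2}$, $G_{26}\cong\mathbb{Z}_{p^4}\times\mathbb{Z}_p$, $G_{43}\cong\mathbb{Z}_{p^2}\times\mathbb{Z}_{p^2}\times\mathbb{Z}_p$, $G_{51}\cong\mathbb{Z}_{p^3}\times\mathbb{Z}_p\times\mathbb{Z}_p$, $G_{66}\cong\mathbb{Z}_{p^2}\times\mathbb{Z}_p\times\mathbb{Z}_p\times\mathbb{Z}_p$, $G_{70}\cong\mathbb{Z}_p^{(5)}$. For a group $G$ write ${}^{g}g'=gg'g^{-1}$. The non-abelian tensor square $G\otimes G$ is the group generated by symbols $g\otimes h$ ($g,h\in G$) subject to $gg'\otimes h=({}^{g}g'\otimes{}^{g}h)(g\otimes h)$ and $g\otimes hh'=(g\otimes h)({}^{h}g\otimes{}^{h}h')$ for all $g,g',h,h'\in G$. $J_2(G)$ is the kernel of the homomorphism $\kappa:G\otimes G\to G'$, $g\otimes h\mapsto [g,h]=ghg^{-1}h^{-1}$; it is isomorphic to the third homotopy group $\Pi_3(SK(G,1))$ of the suspension of an Eilenberg–MacLane space $K(G,1)$. *)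

theory Defs
  imports "HOL-Algebra.Algebra" "HOL-Computational_Algebra.Primes"
begin

section \<open>Groups given by generators and relations\<close>

text \<open>
  A word over \<open>S\<close> is a list of letters \<open>(True, x)\<close>, standing for \<open>x\<close>, and \<open>(False, x)\<close>,
  standing for the formal inverse of \<open>x\<close>.
\<close>

type_synonym 'x word = "(bool \<times> 'x) list"

definition words :: "'x set \<Rightarrow> 'x word set" where
  "words S = lists (UNIV \<times> S)"

definition letter :: "'x \<Rightarrow> 'x word" where
  "letter x = [(True, x)]"

text \<open>
  The least congruence on words that contains free cancellation and the defining relations
  \<open>u = v\<close> for \<open>(u, v) \<in> R\<close>.
\<close>

inductive pres_cong :: "'x set \<Rightarrow> ('x word \<times> 'x word) set \<Rightarrow> 'x word \<Rightarrow> 'x word \<Rightarrow> bool"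
  for S :: "'x set" and R :: "('x word \<times> 'x word) set" where
  cancel: "x \<in> S \<Longrightarrow> pres_cong S R [(b, x), (\<not> b, x)] []"
| rel: "(u, v) \<in> R \<Longrightarrow> pres_cong S R u v"
| refl: "pres_cong S R u u"
| sym: "pres_cong S R u v \<Longrightarrow> pres_cong S R v u"
| trans: "pres_cong S R u v \<Longrightarrow> pres_cong S R v w \<Longrightarrow> pres_cong S R u w"
| app: "pres_cong S R u u' \<Longrightarrow> pres_cong S R v v' \<Longrightarrow> pres_cong S R (u @ v) (u' @ v')"

definition pres_class :: "'x set \<Rightarrow> ('x word \<times> 'x word) set \<Rightarrow> 'x word \<Rightarrow> 'x word set" where
  "pres_class S R u = {v \<in> words S. pres_cong S R u v}"

definition presented_group :: "'x set \<Rightarrow> ('x word \<times> 'x word) set \<Rightarrow> 'x word set monoid" where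
  "presented_group S R =
    \<lparr>carrier = pres_class S R ` words S,
     monoid.mult = (\<lambda>A B. \<Union>u\<in>A. \<Union>v\<in>B. pres_class S R (u @ v)),
     one = pres_class S R []\<rparr>"

definition word_value :: "('g, 'm) monoid_scheme \<Rightarrow> ('x \<Rightarrow> 'g) \<Rightarrow> 'x word \<Rightarrow> 'g" where
  "word_value H f w =
    foldr (\<lambda>(b, x) y. (if b then f x else inv\<^bsub>H\<^esub> (f x)) \<otimes>\<^bsub>H\<^esub> y) w \<one>\<^bsub>H\<^esub>"


section \<open>The non-abelian tensor square\<close>

definition conj_by :: "('a, 'm) monoid_scheme \<Rightarrow> 'a \<Rightarrow> 'a \<Rightarrow> 'a" where
  "conj_by G g g' = g \<otimes>\<^bsub>G\<^esub> g' \<otimes>\<^bsub>G\<^esub> inv\<^bsub>G\<^esub> g"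

definition commutator :: "('a, 'm) monoid_scheme \<Rightarrow> 'a \<Rightarrow> 'a \<Rightarrow> 'a" where
  "commutator G g h = g \<otimes>\<^bsub>G\<^esub> h \<otimes>\<^bsub>G\<^esub> inv\<^bsub>G\<^esub> g \<otimes>\<^bsub>G\<^esub> inv\<^bsub>G\<^esub> h"

definition tensor_relations :: "('a, 'm) monoid_scheme \<Rightarrow> (('a \<times> 'a) word \<times> ('a \<times> 'a) word) set" where
  "tensor_relations G =
     {(letter (g \<otimes>\<^bsub>G\<^esub> g', h), letter (conj_by G g g', conj_by G g h) @ letter (g, h)) | g g' h.
        g \<in> carrier G \<and> g' \<in> carrier G \<and> h \<in> carrier G} \<union>
     {(letter (g, h \<otimes>\<^bsub>G\<^esub> h'), letter (g, h) @ letter (conj_by G h g, conj_by G h h')) | g h h'.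
        g \<in> carrier G \<and> h \<in> carrier G \<and> h' \<in> carrier G}"

definition tensor_square :: "('a, 'm) monoid_scheme \<Rightarrow> ('a \<times> 'a) word set monoid" where
  "tensor_square G = presented_group (carrier G \<times> carrier G) (tensor_relations G)"

definition tensor :: "('a, 'm) monoid_scheme \<Rightarrow> 'a \<Rightarrow> 'a \<Rightarrow> ('a \<times> 'a) word set" where
  "tensor G g h = pres_class (carrier G \<times> carrier G) (tensor_relations G) (letter (g, h))"

definition derived_group :: "('a, 'm) monoid_scheme \<Rightarrow> ('a, 'm) monoid_scheme" where
  "derived_group G = G\<lparr>carrier := derived G (carrier G)\<rparr>"

text \<open>
  All words in a class have the same value, so the element selected here is unique; see
  \<open>kappa_hom\<close> and \<open>kappa_tensor\<close> below.
\<close>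

definition kappa :: "('a, 'm) monoid_scheme \<Rightarrow> ('a \<times> 'a) word set \<Rightarrow> 'a" where
  "kappa G A = the_elem (word_value G (\<lambda>(g, h). commutator G g h) ` A)"

definition J2 :: "('a, 'm) monoid_scheme \<Rightarrow> ('a \<times> 'a) word set monoid" where
  "J2 G = (tensor_square G)
     \<lparr>carrier := kernel (tensor_square G) (derived_group G) (kappa G)\<rparr>"


section \<open>Direct sums of copies of a group\<close>

definition copies :: "nat \<Rightarrow> ('a, 'm) monoid_scheme \<Rightarrow> (nat \<Rightarrow> 'a) monoid" where
  "copies n A = sum_group {..<n} (\<lambda>_. A)"


section \<open>Well-definedness\<close>

lemma words_append [simp]: "u @ v \<in> words S \<longleftrightarrow> u \<in> words S \<and> v \<in> words S"
  by (auto simp: words_def)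

lemma Nil_in_words [simp]: "[] \<in> words S"
  by (simp add: words_def)

lemma letter_in_words [simp]: "letter x \<in> words S \<longleftrightarrow> x \<in> S"
  by (auto simp: words_def letter_def)

lemma pres_class_self: "u \<in> words S \<Longrightarrow> u \<in> pres_class S R u"
  by (simp add: pres_class_def pres_cong.refl)

lemma pres_class_eqI: "pres_cong S R u v \<Longrightarrow> pres_class S R u = pres_class S R v"
  unfolding pres_class_def by (blast intro: pres_cong.sym pres_cong.trans)

lemma presented_group_mult:
  assumes "u \<in> words S" "v \<in> words S"
  shows "pres_class S R u \<otimes>\<^bsub>presented_group S R\<^esub> pres_class S R v = pres_class S R (u @ v)"
proof -
  have "pres_class S R (u' @ v') = pres_class S R (u @ v)"
    if "u' \<in> pres_class S R u" "v' \<in> pres_class S R v" for u' v'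
    using that by (intro pres_class_eqI) (auto simp: pres_class_def intro: pres_cong.sym pres_cong.app)
  then have "(\<Union>u'\<in>pres_class S R u. \<Union>v'\<in>pres_class S R v. pres_class S R (u' @ v')) =
      (\<Union>u'\<in>pres_class S R u. \<Union>v'\<in>pres_class S R v. pres_class S R (u @ v))"
    by (intro SUP_cong HOL.refl)
  also have "\<dots> = pres_class S R (u @ v)"
    using pres_class_self[OF assms(1), of R] pres_class_self[OF assms(2), of R] by blast
  finally show ?thesis
    by (simp add: presented_group_def)
qed

lemma presented_group_carrier: "carrier (presented_group S R) = pres_class S R ` words S"
  by (simp add: presented_group_def)

lemma presented_group_one: "\<one>\<^bsub>presented_group S R\<^esub> = pres_class S R []"
  by (simp add: presented_group_def)

lemma pres_inverse_word:
  assumes "u \<in> words S"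
  shows "\<exists>v\<in>words S. pres_cong S R (v @ u) []"
  using assms
proof (induction u rule: rev_induct)
  case Nil
  then show ?case by (auto intro!: bexI[of _ "[]"] pres_cong.refl)
next
  case (snoc a u)
  obtain b x where a: "a = (b, x)" by force
  from snoc.prems a have x: "x \<in> S" and u: "u \<in> words S" by (auto simp: words_def)
  from snoc.IH[OF u] obtain v where v: "v \<in> words S" "pres_cong S R (v @ u) []" by blast
  have mid: "pres_cong S R ([(\<not> b, x)] @ ((v @ u) @ [(b, x)])) ([(\<not> b, x)] @ ([] @ [(b, x)]))"
    by (intro pres_cong.app pres_cong.refl v)
  have "pres_cong S R [(\<not> b, x), (b, x)] []"
    using pres_cong.cancel[OF x, of R "\<not> b"] by simp
  with mid have "pres_cong S R (((\<not> b, x) # v) @ (u @ [a])) []"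
    using a by (auto intro: pres_cong.trans)
  moreover have "(\<not> b, x) # v \<in> words S"
    using v x by (simp add: words_def)
  ultimately show ?case by blast
qed

lemma group_presented_group: "group (presented_group S R)"
proof (rule groupI)
  fix A assume "A \<in> carrier (presented_group S R)"
  then obtain u where u: "u \<in> words S" "A = pres_class S R u"
    by (auto simp: presented_group_carrier)
  then obtain v where v: "v \<in> words S" "pres_cong S R (v @ u) []"
    using pres_inverse_word by blast
  have "pres_class S R v \<otimes>\<^bsub>presented_group S R\<^esub> A = \<one>\<^bsub>presented_group S R\<^esub>"
    using u v pres_class_eqI[OF v(2)] by (simp add: presented_group_one presented_group_mult)
  then show "\<exists>B\<in>carrier (presented_group S R). B \<otimes>\<^bsub>presented_group S R\<^esub> A = \<one>\<^bsub>presented_group S R\<^esub>"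
    using v(1) unfolding presented_group_carrier by blast
next
  show "\<one>\<^bsub>presented_group S R\<^esub> \<in> carrier (presented_group S R)"
    unfolding presented_group_carrier presented_group_one by (rule imageI) simp
next
  fix A B assume "A \<in> carrier (presented_group S R)" "B \<in> carrier (presented_group S R)"
  then obtain u v where "u \<in> words S" "A = pres_class S R u" "v \<in> words S" "B = pres_class S R v"
    unfolding presented_group_carrier by blast
  then show "A \<otimes>\<^bsub>presented_group S R\<^esub> B \<in> carrier (presented_group S R)"
    by (simp add: presented_group_mult presented_group_carrier)
next
  fix A B C
  assume "A \<in> carrier (presented_group S R)" "B \<in> carrier (presented_group S R)"
    "C \<in> carrier (presented_group S R)"
  then obtain u v w where "u \<in> words S" "A = pres_class S R u" "v \<in> words S" "B = pres_class S R v"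
    "w \<in> words S" "C = pres_class S R w"
    unfolding presented_group_carrier by blast
  then show "A \<otimes>\<^bsub>presented_group S R\<^esub> B \<otimes>\<^bsub>presented_group S R\<^esub> C =
      A \<otimes>\<^bsub>presented_group S R\<^esub> (B \<otimes>\<^bsub>presented_group S R\<^esub> C)"
    by (simp add: presented_group_mult)
next
  fix A assume "A \<in> carrier (presented_group S R)"
  then obtain u where "u \<in> words S" "A = pres_class S R u"
    unfolding presented_group_carrier by blast
  then show "\<one>\<^bsub>presented_group S R\<^esub> \<otimes>\<^bsub>presented_group S R\<^esub> A = A"
    by (simp add: presented_group_mult presented_group_one)
qed

lemma group_tensor_square: "group (tensor_square G)"
  by (simp add: tensor_square_def group_presented_group)

context group
begin

lemma word_value_closed:
  assumes "f \<in> S \<rightarrow> carrier G" "w \<in> words S"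
  shows "word_value G f w \<in> carrier G"
  using assms(2)
proof (induction w)
  case (Cons a w)
  then show ?case using assms(1) by (cases a) (auto simp: word_value_def words_def)
qed (simp add: word_value_def)

lemma word_value_append:
  assumes "f \<in> S \<rightarrow> carrier G" "u \<in> words S" "v \<in> words S"
  shows "word_value G f (u @ v) = word_value G f u \<otimes> word_value G f v"
  using assms(2)
proof (induction u)
  case Nil
  then show ?case using word_value_closed[OF assms(1,3)] by (simp add: word_value_def)
next
  case (Cons a u)
  obtain b x where a: "a = (b, x)" by force
  have x: "f x \<in> carrier G" and u: "u \<in> words S"
    using Cons.prems a assms(1) by (auto simp: words_def)
  have *: "word_value G f (a # w) = (if b then f x else inv (f x)) \<otimes> word_value G f w" for w
    by (simp add: word_value_def a)
  show ?case
    using Cons.IH[OF u] x word_value_closed[OF assms(1) u] word_value_closed[OF assms(1,3)]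
    by (simp add: * m_assoc)
qed

lemma word_value_cong:
  assumes f: "f \<in> S \<rightarrow> carrier G"
    and R: "\<And>u v. (u, v) \<in> R \<Longrightarrow> u \<in> words S \<and> v \<in> words S \<and> word_value G f u = word_value G f v"
    and "pres_cong S R u v"
  shows "(u \<in> words S \<longleftrightarrow> v \<in> words S) \<and> (u \<in> words S \<longrightarrow> word_value G f u = word_value G f v)"
  using assms(3)
proof induction
  case (cancel x b)
  then have "f x \<in> carrier G" using f by auto
  with cancel show ?case by (cases b) (auto simp: word_value_def words_def)
next
  case (app u u' v v')
  then show ?case using word_value_append[OF f] by auto
qed (use R in auto)

lemma commutator_closed: "(\<lambda>(g, h). commutator G g h) \<in> carrier G \<times> carrier G \<rightarrow> carrier G"
  by (auto simp: commutator_def)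

lemma inv_cancel_left:
  assumes "x \<in> carrier G" "y \<in> carrier G"
  shows "inv x \<otimes> (x \<otimes> y) = y" "x \<otimes> (inv x \<otimes> y) = y"
  using assms by (simp_all add: m_assoc[symmetric])

lemma commutator_mult_left:
  assumes "g \<in> carrier G" "g' \<in> carrier G" "h \<in> carrier G"
  shows "commutator G (g \<otimes> g') h = commutator G (conj_by G g g') (conj_by G g h) \<otimes> commutator G g h"
  using assms by (simp add: commutator_def conj_by_def m_assoc inv_mult_group inv_cancel_left)

lemma commutator_mult_right:
  assumes "g \<in> carrier G" "h \<in> carrier G" "h' \<in> carrier G"
  shows "commutator G g (h \<otimes> h') = commutator G g h \<otimes> commutator G (conj_by G h g) (conj_by G h h')"
  using assms by (simp add: commutator_def conj_by_def m_assoc inv_mult_group inv_cancel_left)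

lemma word_value_letter:
  assumes "f x \<in> carrier G"
  shows "word_value G f (letter x) = f x"
  using assms by (simp add: word_value_def letter_def)

lemma conj_by_closed: "g \<in> carrier G \<Longrightarrow> h \<in> carrier G \<Longrightarrow> conj_by G g h \<in> carrier G"
  by (simp add: conj_by_def)

lemma commutator_in_carrier: "g \<in> carrier G \<Longrightarrow> h \<in> carrier G \<Longrightarrow> commutator G g h \<in> carrier G"
  by (simp add: commutator_def)

lemma tensor_relations_value:
  assumes "(u, v) \<in> tensor_relations G"
  shows "u \<in> words (carrier G \<times> carrier G) \<and> v \<in> words (carrier G \<times> carrier G) \<and>
    word_value G (\<lambda>(g, h). commutator G g h) u = word_value G (\<lambda>(g, h). commutator G g h) v"
  using assms
  by (auto simp: tensor_relations_def conj_by_closed commutator_in_carrier word_value_letter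
      word_value_append[OF commutator_closed] commutator_mult_left commutator_mult_right)

lemma kappa_pres_class:
  assumes u: "u \<in> words (carrier G \<times> carrier G)"
  shows "kappa G (pres_class (carrier G \<times> carrier G) (tensor_relations G) u) =
    word_value G (\<lambda>(g, h). commutator G g h) u"
proof -
  have "word_value G (\<lambda>(g, h). commutator G g h) `
      pres_class (carrier G \<times> carrier G) (tensor_relations G) u =
      {word_value G (\<lambda>(g, h). commutator G g h) u}"
  proof (intro equalityI subsetI)
    fix y assume "y \<in> word_value G (\<lambda>(g, h). commutator G g h) `
      pres_class (carrier G \<times> carrier G) (tensor_relations G) u"
    then show "y \<in> {word_value G (\<lambda>(g, h). commutator G g h) u}"
      using word_value_cong[OF commutator_closed tensor_relations_value] u
      by (fastforce simp: pres_class_def)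
  qed (use pres_class_self[OF u] in auto)
  then show ?thesis by (simp add: kappa_def)
qed

lemma word_value_commutator_in_derived:
  assumes "w \<in> words (carrier G \<times> carrier G)"
  shows "word_value G (\<lambda>(g, h). commutator G g h) w \<in> derived G (carrier G)"
  using assms
proof (induction w)
  case Nil
  then show ?case by (simp add: word_value_def derived_def generate.one)
next
  case (Cons a w)
  obtain b g h where a: "a = (b, g, h)" by (metis surj_pair)
  have gh: "g \<in> carrier G" "h \<in> carrier G" and w: "w \<in> words (carrier G \<times> carrier G)"
    using Cons.prems a by (auto simp: words_def)
  have "commutator G g h \<in> derived_set G (carrier G)"
    using gh by (auto simp: commutator_def)
  then have "(if b then commutator G g h else inv (commutator G g h)) \<in> derived G (carrier G)"
    by (auto simp: derived_def intro: generate.incl generate.inv)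
  then show ?case
    using Cons.IH[OF w] by (cases b) (simp_all add: a word_value_def derived_def generate.eng)
qed

lemma kappa_hom: "kappa G \<in> hom (tensor_square G) (derived_group G)"
  by (rule homI)
    (auto simp: tensor_square_def derived_group_def presented_group_carrier presented_group_mult
      kappa_pres_class word_value_append[OF commutator_closed] word_value_commutator_in_derived)

lemma kappa_tensor:
  assumes "g \<in> carrier G" "h \<in> carrier G"
  shows "kappa G (tensor G g h) = commutator G g h"
  using assms by (simp add: tensor_def kappa_pres_class word_value_letter commutator_in_carrier)

end

end

theory Submission
  imports Defs "HOL-Combinatorics.Permutations"
begin

text \<open>
  For abelian \<open>G\<close> the commutator map \<open>\<kappa>\<close> is trivial, so \<open>J\<^sub>2(G) = G \<otimes> G\<close>, and conjugation is
  trivial, so the defining relations say that \<open>\<otimes>\<close> is bilinear; in particular \<open>G \<otimes> G\<close> is abelian and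
  is the ordinary tensor square. If \<open>G\<close> is the product of cyclic groups of orders \<open>n\<^sub>i\<close> with
  generators \<open>e\<^sub>i\<close>, then \<open>e\<^sub>i \<otimes> e\<^sub>j\<close> is killed by \<open>gcd n\<^sub>i n\<^sub>j\<close>, and coordinatewise multiplication
  modulo \<open>gcd n\<^sub>i n\<^sub>j\<close> is bilinear. This yields mutually inverse homomorphisms between \<open>G \<otimes> G\<close> and
  the product of the cyclic groups of orders \<open>gcd n\<^sub>i n\<^sub>j\<close>.
\<close>

section \<open>Presented groups\<close>

lemma pres_class_in_carrier: "u \<in> words S \<Longrightarrow> pres_class S R u \<in> carrier (presented_group S R)"
  by (simp add: presented_group_carrier)

text \<open>The letter classes generate: a word is peeled off from the left, and free cancellation
  makes the class of an inverse letter the inverse of a class in \<open>K\<close>.\<close>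

lemma presented_group_subset_subgroup:
  assumes K: "subgroup K (presented_group S R)"
    and letters: "\<And>x. x \<in> S \<Longrightarrow> pres_class S R (letter x) \<in> K"
  shows "carrier (presented_group S R) \<subseteq> K"
proof -
  interpret P: group "presented_group S R" by (rule group_presented_group)
  have "pres_class S R u \<in> K" if "u \<in> words S" for u
    using that
  proof (induction u)
    case Nil
    then show ?case using subgroup.one_closed[OF K] by (simp add: presented_group_one)
  next
    case (Cons a u)
    obtain b x where a: "a = (b, x)" by force
    have x: "x \<in> S" and u: "u \<in> words S"
      using Cons.prems a by (auto simp: words_def)
    have wx: "[(c, x)] \<in> words S" for c using x by (simp add: words_def)
    have "pres_class S R [(False, x)] \<otimes>\<^bsub>presented_group S R\<^esub> pres_class S R (letter x) =
        \<one>\<^bsub>presented_group S R\<^esub>"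
      using x wx pres_class_eqI[OF pres_cong.cancel[OF x, of R False]]
      by (simp add: presented_group_mult presented_group_one letter_def)
    then have "pres_class S R [(False, x)] = inv\<^bsub>presented_group S R\<^esub> pres_class S R (letter x)"
      using x wx by (intro P.inv_equality[symmetric]) (auto intro!: pres_class_in_carrier)
    then have "pres_class S R [(b, x)] \<in> K"
      using letters[OF x] subgroup.m_inv_closed[OF K letters[OF x]] by (cases b) (auto simp: letter_def)
    then have "pres_class S R [(b, x)] \<otimes>\<^bsub>presented_group S R\<^esub> pres_class S R u \<in> K"
      using Cons.IH[OF u] by (rule subgroup.m_closed[OF K])
    then show ?case using wx u by (simp add: presented_group_mult a)
  qed
  then show ?thesis by (auto simp: presented_group_carrier)
qed

text \<open>Passing to the subgroup of agreement lets two homomorphisms be compared on generators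
  only, both for presented groups and for products of cyclic groups.\<close>

lemma subgroup_equalizer:
  assumes "group G" "group H" and f: "f \<in> hom G H" and g: "g \<in> hom G H"
  shows "subgroup {x \<in> carrier G. f x = g x} G"
proof -
  interpret f: group_hom G H f using assms by (simp add: group_hom_def group_hom_axioms_def)
  interpret g: group_hom G H g using assms by (simp add: group_hom_def group_hom_axioms_def)
  show ?thesis by (rule group.subgroupI[OF assms(1)]) (auto intro!: exI[of _ "\<one>\<^bsub>G\<^esub>"])
qed

lemma presented_group_hom_eqI:
  assumes "group H" "f \<in> hom (presented_group S R) H" "g \<in> hom (presented_group S R) H"
    and "\<And>x. x \<in> S \<Longrightarrow> f (pres_class S R (letter x)) = g (pres_class S R (letter x))"
    and "A \<in> carrier (presented_group S R)"
  shows "f A = g A"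
  using presented_group_subset_subgroup[OF
      subgroup_equalizer[OF group_presented_group assms(1,2,3)]] assms(4,5)
  by (auto simp: pres_class_in_carrier)

lemma (in group) subgroup_centralizer:
  assumes a: "a \<in> carrier G"
  shows "subgroup {x \<in> carrier G. x \<otimes> a = a \<otimes> x} G"
proof (rule subgroupI)
  fix x assume "x \<in> {x \<in> carrier G. x \<otimes> a = a \<otimes> x}"
  then show "inv x \<in> {x \<in> carrier G. x \<otimes> a = a \<otimes> x}"
    using a by simp (metis inv_closed inv_solve_left inv_solve_right m_assoc m_closed)
next
  fix x y assume "x \<in> {x \<in> carrier G. x \<otimes> a = a \<otimes> x}" "y \<in> {x \<in> carrier G. x \<otimes> a = a \<otimes> x}"
  then show "x \<otimes> y \<in> {x \<in> carrier G. x \<otimes> a = a \<otimes> x}"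
    using a by simp (metis m_assoc)
qed (use a in \<open>auto intro!: exI[of _ "\<one>"]\<close>)

text \<open>Two passes through centralizers: the centralizer of a single letter contains all letters
  and hence everything; then the centralizer of an arbitrary element contains all letters
  too.\<close>

lemma presented_group_comm:
  assumes "\<And>x y. x \<in> S \<Longrightarrow> y \<in> S \<Longrightarrow>
    pres_class S R (letter x) \<otimes>\<^bsub>presented_group S R\<^esub> pres_class S R (letter y) =
    pres_class S R (letter y) \<otimes>\<^bsub>presented_group S R\<^esub> pres_class S R (letter x)"
  shows "comm_group (presented_group S R)"
proof -
  interpret P: group "presented_group S R" by (rule group_presented_group)
  have *: "A \<otimes>\<^bsub>presented_group S R\<^esub> pres_class S R (letter y) =
      pres_class S R (letter y) \<otimes>\<^bsub>presented_group S R\<^esub> A"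
    if "A \<in> carrier (presented_group S R)" "y \<in> S" for A y
    using presented_group_subset_subgroup[OF P.subgroup_centralizer[of "pres_class S R (letter y)"]]
      that assms by (auto simp: pres_class_in_carrier)
  have "A \<otimes>\<^bsub>presented_group S R\<^esub> B = B \<otimes>\<^bsub>presented_group S R\<^esub> A"
    if "A \<in> carrier (presented_group S R)" "B \<in> carrier (presented_group S R)" for A B
    using presented_group_subset_subgroup[OF P.subgroup_centralizer[of B]]
      that * by (auto simp: pres_class_in_carrier)
  then show ?thesis by (rule P.group_comm_groupI)
qed

text \<open>Universal property of a presentation. The map evaluates an arbitrary representative of a
  class, and \<open>word_value_cong\<close> shows that the choice does not matter.\<close>

lemma (in group) presented_group_lift:
  assumes f: "f \<in> S \<rightarrow> carrier G"
    and R: "\<And>u v. (u, v) \<in> R \<Longrightarrow> u \<in> words S \<and> v \<in> words S \<and> word_value G f u = word_value G f v"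
  shows "\<exists>\<phi>\<in>hom (presented_group S R) G. \<forall>x\<in>S. \<phi> (pres_class S R (letter x)) = f x"
proof -
  define \<phi> where "\<phi> A = word_value G f (SOME u. u \<in> A)" for A
  have \<phi>: "\<phi> (pres_class S R u) = word_value G f u" if u: "u \<in> words S" for u
  proof -
    have "(SOME v. v \<in> pres_class S R u) \<in> pres_class S R u"
      using pres_class_self[OF u] by (rule someI)
    then show ?thesis
      using word_value_cong[OF f R] u by (force simp: \<phi>_def pres_class_def)
  qed
  have "\<phi> \<in> hom (presented_group S R) G"
    by (rule homI) (auto simp: presented_group_carrier presented_group_mult \<phi>
        word_value_append[OF f] word_value_closed[OF f])
  moreover have "\<forall>x\<in>S. \<phi> (pres_class S R (letter x)) = f x"
    using f by (auto simp: \<phi> intro!: word_value_letter)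
  ultimately show ?thesis by blast
qed


section \<open>The tensor square of an abelian group\<close>

lemma tensor_in_carrier:
  "g \<in> carrier G \<Longrightarrow> h \<in> carrier G \<Longrightarrow> tensor G g h \<in> carrier (tensor_square G)"
  by (simp add: tensor_def tensor_square_def pres_class_in_carrier)

lemma tensor_square_hom_eqI:
  assumes "group H" "f \<in> hom (tensor_square G) H" "f' \<in> hom (tensor_square G) H"
    and "\<And>g h. g \<in> carrier G \<Longrightarrow> h \<in> carrier G \<Longrightarrow> f (tensor G g h) = f' (tensor G g h)"
    and "A \<in> carrier (tensor_square G)"
  shows "f A = f' A"
proof (rule presented_group_hom_eqI[OF assms(1) assms(2,3)[unfolded tensor_square_def] _
      assms(5)[unfolded tensor_square_def]])
  fix x assume "x \<in> carrier G \<times> carrier G"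
  then show "f (pres_class (carrier G \<times> carrier G) (tensor_relations G) (letter x)) =
      f' (pres_class (carrier G \<times> carrier G) (tensor_relations G) (letter x))"
    using assms(4) by (auto simp: tensor_def)
qed

context comm_group
begin

section \<open>Bilinearity and commutativity of the tensor symbols\<close>

lemma conj_by_eq: "g \<in> carrier G \<Longrightarrow> h \<in> carrier G \<Longrightarrow> conj_by G g h = h"
  by (simp add: conj_by_def m_comm[of g h] m_assoc)

lemma commutator_eq_one: "g \<in> carrier G \<Longrightarrow> h \<in> carrier G \<Longrightarrow> commutator G g h = \<one>"
  by (simp add: commutator_def m_comm[of g h] m_assoc inv_cancel_left)

text \<open>Conjugation drops out of the first defining relation, but the factors keep its reversed
  order, because commutativity of the tensor square is itself derived from this lemma.\<close>

lemma tensor_mult_left_swapped: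
  assumes "g \<in> carrier G" "g' \<in> carrier G" "h \<in> carrier G"
  shows "tensor G (g \<otimes> g') h = tensor G g' h \<otimes>\<^bsub>tensor_square G\<^esub> tensor G g h"
proof -
  have "(letter (g \<otimes> g', h), letter (conj_by G g g', conj_by G g h) @ letter (g, h))
      \<in> tensor_relations G"
    using assms unfolding tensor_relations_def by blast
  from pres_class_eqI[OF pres_cong.rel[OF this]] show ?thesis
    using assms by (simp add: tensor_def tensor_square_def presented_group_mult conj_by_eq)
qed

lemma tensor_mult_right:
  assumes "g \<in> carrier G" "h \<in> carrier G" "h' \<in> carrier G"
  shows "tensor G g (h \<otimes> h') = tensor G g h \<otimes>\<^bsub>tensor_square G\<^esub> tensor G g h'"
proof -
  have "(letter (g, h \<otimes> h'), letter (g, h) @ letter (conj_by G h g, conj_by G h h'))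
      \<in> tensor_relations G"
    using assms unfolding tensor_relations_def by blast
  from pres_class_eqI[OF pres_cong.rel[OF this]] show ?thesis
    using assms by (simp add: tensor_def tensor_square_def presented_group_mult conj_by_eq)
qed

text \<open>Expanding \<open>(g' g) \<otimes> (h' h)\<close> in the two possible orders and cancelling the outer factors.\<close>

lemma tensor_commute:
  assumes "g \<in> carrier G" "g' \<in> carrier G" "h \<in> carrier G" "h' \<in> carrier G"
  shows "tensor G g h \<otimes>\<^bsub>tensor_square G\<^esub> tensor G g' h' =
    tensor G g' h' \<otimes>\<^bsub>tensor_square G\<^esub> tensor G g h"
proof -
  interpret T: group "tensor_square G" by (rule group_tensor_square)
  note c = tensor_in_carrier assms
  have "tensor G g h' \<otimes>\<^bsub>tensor_square G\<^esub> (tensor G g h \<otimes>\<^bsub>tensor_square G\<^esub>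
        tensor G g' h') \<otimes>\<^bsub>tensor_square G\<^esub> tensor G g' h
      = tensor G (g' \<otimes> g) (h' \<otimes> h)"
    using assms by (subst tensor_mult_left_swapped) (simp_all add: tensor_mult_right T.m_assoc c)
  also have "\<dots> = tensor G g h' \<otimes>\<^bsub>tensor_square G\<^esub> (tensor G g' h' \<otimes>\<^bsub>tensor_square G\<^esub>
        tensor G g h) \<otimes>\<^bsub>tensor_square G\<^esub> tensor G g' h"
    using assms by (subst tensor_mult_right) (simp_all add: tensor_mult_left_swapped T.m_assoc c)
  finally show ?thesis using assms by (simp add: tensor_in_carrier)
qed

lemma comm_group_tensor_square: "comm_group (tensor_square G)"
  unfolding tensor_square_def
  by (rule presented_group_comm)
    (auto simp: tensor_commute[unfolded tensor_def tensor_square_def])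

lemma tensor_hom_left:
  assumes "h \<in> carrier G"
  shows "(\<lambda>g. tensor G g h) \<in> hom G (tensor_square G)"
  using assms by (auto intro!: homI
      simp: tensor_in_carrier tensor_mult_left_swapped tensor_commute)

lemma tensor_hom_right:
  assumes "g \<in> carrier G"
  shows "tensor G g \<in> hom G (tensor_square G)"
  using assms by (auto intro!: homI simp: tensor_in_carrier tensor_mult_right)

text \<open>Universal property for bilinear maps. Commutativity of \<open>K\<close> absorbs the
  reversed order of factors in the first family of relations.\<close>

lemma tensor_square_lift:
  assumes "comm_group K"
    and left: "\<And>h. h \<in> carrier G \<Longrightarrow> (\<lambda>g. \<beta> g h) \<in> hom G K"
    and right: "\<And>g. g \<in> carrier G \<Longrightarrow> \<beta> g \<in> hom G K"
  shows "\<exists>\<phi>\<in>hom (tensor_square G) K.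
    \<forall>g\<in>carrier G. \<forall>h\<in>carrier G. \<phi> (tensor G g h) = \<beta> g h"
proof -
  interpret K: comm_group K by fact
  have closed: "\<beta> g h \<in> carrier K" if "g \<in> carrier G" "h \<in> carrier G" for g h
    using hom_in_carrier[OF right] that by blast
  then have cl: "(\<lambda>(g, h). \<beta> g h) \<in> carrier G \<times> carrier G \<rightarrow> carrier K" by auto
  have "u \<in> words (carrier G \<times> carrier G) \<and> v \<in> words (carrier G \<times> carrier G) \<and>
      word_value K (\<lambda>(g, h). \<beta> g h) u = word_value K (\<lambda>(g, h). \<beta> g h) v"
    if "(u, v) \<in> tensor_relations G" for u v
    using that hom_mult[OF left] hom_mult[OF right] closed
    by (auto simp: tensor_relations_def conj_by_eq K.word_value_letter K.word_value_append[OF cl]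
        K.m_comm)
  from K.presented_group_lift[OF cl this] show ?thesis
    by (auto simp: tensor_square_def tensor_def)
qed

text \<open>Every letter evaluates to a commutator, hence to the identity, so the kernel is the
  whole carrier. As \<open>J2\<close> changes only the carrier, this is an equality and not merely
  an isomorphism.\<close>

lemma J2_eq_tensor_square: "J2 G = tensor_square G"
proof -
  have "word_value G (\<lambda>(g, h). commutator G g h) w = \<one>"
    if "w \<in> words (carrier G \<times> carrier G)" for w
    using that
  proof (induction w)
    case (Cons a w)
    then show ?case by (cases a) (auto simp: word_value_def words_def commutator_eq_one)
  qed (simp add: word_value_def)
  then have "kernel (tensor_square G) (derived_group G) (kappa G) = carrier (tensor_square G)"
    by (auto simp: kernel_def derived_group_def tensor_square_def presented_group_carrier
        kappa_pres_class)
  then show ?thesis by (simp add: J2_def)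
qed

text \<open>Division with remainder. The lemma is used to discard the reductions modulo
  \<open>n\<close> that addition in \<open>integer_mod_group n\<close> performs on
  exponents.\<close>

lemma int_pow_mod_eq:
  assumes "x \<in> carrier G" "x [^] n = \<one>"
  shows "x [^] (a mod int n) = x [^] a"
proof -
  have "x [^] a = x [^] (int n * (a div int n) + a mod int n)" by simp
  also have "\<dots> = x [^] (a mod int n)"
    using assms by (simp only: int_pow_mult int_pow_pow[symmetric] int_pow_int) simp
  finally show ?thesis by simp
qed

end


section \<open>Products of cyclic groups\<close>

text \<open>The index set is arbitrary because the tensor square of a product over \<open>I\<close>
  is naturally indexed by \<open>I \<times> I\<close>. A factor with \<open>n i = 0\<close> is
  infinite cyclic.\<close>

definition cyclic_prod :: "'i set \<Rightarrow> ('i \<Rightarrow> nat) \<Rightarrow> ('i \<Rightarrow> int) monoid" where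
  "cyclic_prod I n = product_group I (\<lambda>i. integer_mod_group (n i))"

text \<open>The entry is \<open>1 mod n i\<close> rather than \<open>1\<close> so that trivial factors are allowed.\<close>

definition cyclic_unit :: "'i set \<Rightarrow> ('i \<Rightarrow> nat) \<Rightarrow> 'i \<Rightarrow> 'i \<Rightarrow> int" where
  "cyclic_unit I n i = (\<lambda>j\<in>I. if j = i then 1 mod int (n i) else 0)"

lemma mod_in_integer_mod_group [simp]: "a mod int n \<in> carrier (integer_mod_group n)"
  by (simp add: carrier_integer_mod_group)

lemma integer_mod_group_mod_eq: "a \<in> carrier (integer_mod_group n) \<Longrightarrow> a mod int n = a"
  by (auto simp: carrier_integer_mod_group split: if_splits)

lemma carrier_cyclic_prod: "carrier (cyclic_prod I n) = (\<Pi>\<^sub>E i\<in>I. carrier (integer_mod_group (n i)))"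
  by (simp add: cyclic_prod_def)

lemma mult_cyclic_prod: "x \<otimes>\<^bsub>cyclic_prod I n\<^esub> y = (\<lambda>i\<in>I. (x i + y i) mod int (n i))"
  by (simp add: cyclic_prod_def)

lemma one_cyclic_prod: "\<one>\<^bsub>cyclic_prod I n\<^esub> = (\<lambda>i\<in>I. 0)"
  by (simp add: cyclic_prod_def)

lemma comm_group_cyclic_prod: "comm_group (cyclic_prod I n)"
proof (rule group.group_comm_groupI)
  show "group (cyclic_prod I n)" by (simp add: cyclic_prod_def)
qed (simp add: mult_cyclic_prod add.commute)

lemma cyclic_unit_in_carrier: "cyclic_unit I n i \<in> carrier (cyclic_prod I n)"
  by (auto simp: cyclic_unit_def carrier_cyclic_prod)

text \<open>Each coordinate projection is a homomorphism and so commutes with powers; outside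
  \<open>I\<close> both sides are \<open>undefined\<close>.\<close>

lemma int_pow_cyclic_prod:
  assumes x: "x \<in> carrier (cyclic_prod I n)"
  shows "x [^]\<^bsub>cyclic_prod I n\<^esub> (a::int) = (\<lambda>i\<in>I. (a * x i) mod int (n i))"
proof
  fix i
  interpret P: comm_group "cyclic_prod I n" by (rule comm_group_cyclic_prod)
  have pow: "x [^]\<^bsub>cyclic_prod I n\<^esub> a \<in> carrier (cyclic_prod I n)" using x by simp
  show "(x [^]\<^bsub>cyclic_prod I n\<^esub> a) i = (\<lambda>i\<in>I. (a * x i) mod int (n i)) i"
  proof (cases "i \<in> I")
    case True
    have "(\<lambda>c. c i) \<in> hom (cyclic_prod I n) (integer_mod_group (n i))"
      using True by (auto intro!: homI simp: mult_cyclic_prod carrier_cyclic_prod)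
    from hom_int_pow[OF this x P.is_group group_integer_mod_group, of a] True show ?thesis
      by (simp add: int_pow_integer_mod_group)
  next
    case False
    then show ?thesis using pow by (auto simp: carrier_cyclic_prod PiE_iff extensional_def)
  qed
qed

lemma cyclic_unit_int_pow:
  "cyclic_unit I n i [^]\<^bsub>cyclic_prod I n\<^esub> (a::int) = (\<lambda>j\<in>I. if j = i then a mod int (n i) else 0)"
  by (subst int_pow_cyclic_prod[OF cyclic_unit_in_carrier])
    (auto simp: cyclic_unit_def mod_mult_right_eq intro!: restrict_ext)

lemma cyclic_unit_pow: "cyclic_unit I n i [^]\<^bsub>cyclic_prod I n\<^esub> n i = \<one>\<^bsub>cyclic_prod I n\<^esub>"
proof -
  have "cyclic_unit I n i [^]\<^bsub>cyclic_prod I n\<^esub> int (n i) = \<one>\<^bsub>cyclic_prod I n\<^esub>"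
    by (auto simp: cyclic_unit_int_pow one_cyclic_prod intro!: restrict_ext)
  then show ?thesis by (simp add: int_pow_int)
qed

lemma cyclic_prod_subset_subgroup:
  assumes K: "subgroup K (cyclic_prod I n)" and I: "finite I"
    and units: "\<And>i. i \<in> I \<Longrightarrow> cyclic_unit I n i \<in> K"
  shows "carrier (cyclic_prod I n) \<subseteq> K"
proof -
  interpret P: comm_group "cyclic_prod I n" by (rule comm_group_cyclic_prod)
  \<comment> \<open>The claim is strengthened to elements supported in \<open>J\<close>, so that
    induction on \<open>J\<close> can remove one coordinate at a time; \<open>J = I\<close> gives
    the lemma.\<close>
  have "c \<in> K" if "J \<subseteq> I" "c \<in> carrier (cyclic_prod I n)" "\<And>i. i \<in> I - J \<Longrightarrow> c i = 0" for J c
    using finite_subset[OF that(1) I] that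
  proof (induction J arbitrary: c rule: finite_induct)
    case empty
    then have "c = \<one>\<^bsub>cyclic_prod I n\<^esub>"
      by (auto simp: one_cyclic_prod carrier_cyclic_prod PiE_iff extensional_def)
    then show ?case using subgroup.one_closed[OF K] by simp
  next
    case (insert i J)
    \<comment> \<open>Clearing coordinate \<open>i\<close> leaves support in \<open>J\<close>; the
      lost entry is restored by the unit at \<open>i\<close> raised to the power
      \<open>c i\<close>.\<close>
    define d where "d = c(i := 0)"
    have i: "i \<in> I" using insert by auto
    have "d \<in> K"
      using insert.prems insert.hyps i
      by (intro insert.IH) (auto simp: d_def carrier_cyclic_prod PiE_iff extensional_def)
    moreover have "cyclic_unit I n i [^]\<^bsub>cyclic_prod I n\<^esub> c i \<in> K"
      using P.subgroup_int_pow_closed[OF K units[OF i]] .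
    ultimately have "cyclic_unit I n i [^]\<^bsub>cyclic_prod I n\<^esub> c i \<otimes>\<^bsub>cyclic_prod I n\<^esub> d \<in> K"
      by (intro subgroup.m_closed[OF K])
    moreover have "cyclic_unit I n i [^]\<^bsub>cyclic_prod I n\<^esub> c i \<otimes>\<^bsub>cyclic_prod I n\<^esub> d = c"
    proof
      fix j
      have "c j = undefined" if "j \<notin> I"
        using that insert.prems(2) by (auto simp: carrier_cyclic_prod PiE_iff extensional_def)
      moreover have "c j mod int (n j) = c j" if "j \<in> I"
        using that insert.prems(2) by (auto simp: carrier_cyclic_prod intro: integer_mod_group_mod_eq)
      ultimately show "(cyclic_unit I n i [^]\<^bsub>cyclic_prod I n\<^esub> c i \<otimes>\<^bsub>cyclic_prod I n\<^esub> d) j = c j"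
        by (auto simp: mult_cyclic_prod cyclic_unit_int_pow d_def)
    qed
    ultimately show ?case by simp
  qed
  from this[of I] show ?thesis by auto
qed

lemma cyclic_prod_hom_eqI:
  assumes "group H" "f \<in> hom (cyclic_prod I n) H" "g \<in> hom (cyclic_prod I n) H" "finite I"
    and "\<And>i. i \<in> I \<Longrightarrow> f (cyclic_unit I n i) = g (cyclic_unit I n i)"
    and "c \<in> carrier (cyclic_prod I n)"
  shows "f c = g c"
  using cyclic_prod_subset_subgroup[OF subgroup_equalizer[OF
        comm_group.axioms(2)[OF comm_group_cyclic_prod] assms(1,2,3)] assms(4)] assms(5,6)
  by (auto simp: cyclic_unit_in_carrier)

text \<open>The homomorphism sends \<open>c\<close> to the product of the \<open>u i\<close> raised
  to \<open>c i\<close>; since \<open>u i\<close> is killed by \<open>n i\<close>, it is compatible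
  with reduction modulo \<open>n i\<close>.\<close>

lemma (in comm_group) cyclic_prod_lift:
  assumes I: "finite I" and u: "\<And>i. i \<in> I \<Longrightarrow> u i \<in> carrier G"
    and pow: "\<And>i. i \<in> I \<Longrightarrow> u i [^] n i = \<one>"
  shows "\<exists>\<psi>\<in>hom (cyclic_prod I n) G. \<forall>i\<in>I. \<psi> (cyclic_unit I n i) = u i"
proof -
  define \<psi> where "\<psi> c = (\<Otimes>i\<in>I. u i [^] (c i :: int))" for c
  have "\<psi> \<in> hom (cyclic_prod I n) G"
  proof (rule homI)
    fix x y assume "x \<in> carrier (cyclic_prod I n)" "y \<in> carrier (cyclic_prod I n)"
    have "\<psi> (x \<otimes>\<^bsub>cyclic_prod I n\<^esub> y) = (\<Otimes>i\<in>I. u i [^] x i \<otimes> u i [^] y i)"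
      unfolding \<psi>_def using u pow
      by (intro finprod_cong') (auto simp: mult_cyclic_prod int_pow_mod_eq int_pow_mult)
    also have "\<dots> = \<psi> x \<otimes> \<psi> y"
      unfolding \<psi>_def using u by (intro finprod_multf) auto
    finally show "\<psi> (x \<otimes>\<^bsub>cyclic_prod I n\<^esub> y) = \<psi> x \<otimes> \<psi> y" .
  qed (use u in \<open>auto simp: \<psi>_def\<close>)
  moreover have "\<psi> (cyclic_unit I n i) = u i" if i: "i \<in> I" for i
  proof -
    have "\<psi> (cyclic_unit I n i) = (\<Otimes>j\<in>I. if i = j then u j else \<one>)"
      unfolding \<psi>_def using u pow i
      by (intro finprod_cong') (auto simp: cyclic_unit_def int_pow_mod_eq)
    also have "\<dots> = u i"
      using finprod_singleton[OF i I, of u] u by auto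
    finally show ?thesis .
  qed
  ultimately show ?thesis by blast
qed


section \<open>The tensor square of a product of cyclic groups\<close>

lemma (in comm_group) tensor_square_iso_cyclic_prod:
  assumes I: "finite I" and iso: "G \<cong> cyclic_prod I n"
  shows "tensor_square G \<cong> cyclic_prod (I \<times> I) (\<lambda>(i, j). gcd (n i) (n j))"
proof -
  let ?m = "\<lambda>(i, j). gcd (n i) (n j)"
  let ?T = "cyclic_prod (I \<times> I) ?m"
  interpret Z: comm_group "cyclic_prod I n" by (rule comm_group_cyclic_prod)
  interpret T: comm_group ?T by (rule comm_group_cyclic_prod)
  interpret S: comm_group "tensor_square G" by (rule comm_group_tensor_square)
  obtain x y where xy: "group_isomorphisms G (cyclic_prod I n) x y"
    using iso iso_iff_group_isomorphisms by (force simp: is_iso_def)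
  then have x: "x \<in> hom G (cyclic_prod I n)" and y: "y \<in> hom (cyclic_prod I n) G"
    and yx: "\<And>g. g \<in> carrier G \<Longrightarrow> y (x g) = g"
    and xy: "\<And>c. c \<in> carrier (cyclic_prod I n) \<Longrightarrow> x (y c) = c"
    by (auto simp: group_isomorphisms_def)
  define e where "e i = y (cyclic_unit I n i)" for i
  have e: "e i \<in> carrier G" for i
    using hom_in_carrier[OF y cyclic_unit_in_carrier] by (simp add: e_def)
  have e_pow: "e i [^] n i = \<one>" for i
    using group_hom.hom_nat_pow[of "cyclic_prod I n" G y "cyclic_unit I n i" "n i"]
      group_hom.hom_one[of "cyclic_prod I n" G y] y
    by (simp add: e_def group_hom_def group_hom_axioms_def cyclic_unit_in_carrier cyclic_unit_pow
        del: hom_nat_pow)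
  have x_e: "x (e i) = cyclic_unit I n i" for i
    by (simp add: e_def xy cyclic_unit_in_carrier)
  \<comment> \<open>The \<open>e i\<close> generate \<open>G\<close>, being the images of the units
    under the isomorphism \<open>y\<close>, so homomorphisms out of \<open>G\<close> can be compared
    on them.\<close>
  have G_hom_eqI: "f g = f' g"
    if "group H" "f \<in> hom G H" "f' \<in> hom G H" "\<And>i. i \<in> I \<Longrightarrow> f (e i) = f' (e i)" "g \<in> carrier G"
    for f f' g and H :: "('x, 'y) monoid_scheme"
  proof -
    have "(f \<circ> y) (x g) = (f' \<circ> y) (x g)"
      by (rule cyclic_prod_hom_eqI[OF that(1) Group.hom_compose[OF y that(2)]
            Group.hom_compose[OF y that(3)] I _ hom_in_carrier[OF x that(5)]])
        (use that(4) in \<open>simp add: e_def\<close>)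
    then show ?thesis using that by (simp add: yx)
  qed

  \<comment> \<open>Entry \<open>(i, j)\<close> multiplies coordinate \<open>i\<close> of the first
    argument by coordinate \<open>j\<close> of the second.\<close>
  define \<beta> where "\<beta> g h = (\<lambda>k\<in>I \<times> I. (x g (fst k) * x h (snd k)) mod int (?m k))" for g h
  have x_mult: "x (g \<otimes> h) i = (x g i + x h i) mod int (n i)"
    if "g \<in> carrier G" "h \<in> carrier G" "i \<in> I" for g h i
    using hom_mult[OF x] that by (simp add: mult_cyclic_prod)
  \<comment> \<open>The gcd divides both moduli, so reductions modulo \<open>n i\<close> or
    \<open>n j\<close> in the coordinates of \<open>x\<close> are invisible modulo the gcd. This is
    what makes \<open>\<beta>\<close> bilinear.\<close>
  have *: "a mod int (n i) * b mod int (gcd (n i) (n j)) = a * b mod int (gcd (n i) (n j))"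
    "b * (a mod int (n j)) mod int (gcd (n i) (n j)) = b * a mod int (gcd (n i) (n j))"
    for a b i j
    by (metis mod_mult_left_eq mod_mod_cancel gcd_dvd1 int_dvd_int_iff)
      (metis mod_mult_right_eq mod_mod_cancel gcd_dvd2 int_dvd_int_iff)
  have "\<exists>\<phi>\<in>hom (tensor_square G) ?T.
    \<forall>g\<in>carrier G. \<forall>h\<in>carrier G. \<phi> (tensor G g h) = \<beta> g h"
  proof (rule tensor_square_lift[OF T.comm_group_axioms])
    have \<beta>_closed: "\<beta> g h \<in> carrier ?T" for g h
      by (auto simp: \<beta>_def carrier_cyclic_prod)
    show "(\<lambda>g. \<beta> g h) \<in> hom G ?T" if "h \<in> carrier G" for h
      using that by (intro homI \<beta>_closed)
        (auto simp: \<beta>_def mult_cyclic_prod x_mult * distrib_right mod_add_eq intro!: restrict_ext)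
    show "\<beta> g \<in> hom G ?T" if "g \<in> carrier G" for g
      using that by (intro homI \<beta>_closed)
        (auto simp: \<beta>_def mult_cyclic_prod x_mult * distrib_left mod_add_eq intro!: restrict_ext)
  qed
  then obtain \<phi> where \<phi>: "\<phi> \<in> hom (tensor_square G) ?T"
    and \<phi>_tensor: "\<And>g h. g \<in> carrier G \<Longrightarrow> h \<in> carrier G \<Longrightarrow> \<phi> (tensor G g h) = \<beta> g h"
    by blast
  \<comment> \<open>An entry \<open>1 mod int (n i)\<close> is \<open>0\<close> when the factor is
    trivial, so even this product of ones has to go through the reduction rules.\<close>
  have \<beta>_e: "\<beta> (e i) (e j) = cyclic_unit (I \<times> I) ?m (i, j)" if "i \<in> I" "j \<in> I" for i j
  proof -
    have "(1 mod int (n i)) * (1 mod int (n j)) mod int (gcd (n i) (n j)) =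
        1 mod int (gcd (n i) (n j))"
      using *(1)[of 1 i "1 mod int (n j)" j] *(2)[of 1 1 j i] by simp
    then show ?thesis
      using that by (auto simp: \<beta>_def x_e cyclic_unit_def fun_eq_iff)
  qed

  \<comment> \<open>Linearity in either slot shows that \<open>n i\<close> and \<open>n j\<close>
    both kill this tensor; its order divides both numbers and hence their gcd.\<close>
  have tensor_pow: "tensor G (e i) (e j) [^]\<^bsub>tensor_square G\<^esub> gcd (n i) (n j) = \<one>\<^bsub>tensor_square G\<^esub>"
    for i j
  proof -
    have hl: "group_hom G (tensor_square G) (\<lambda>g. tensor G g (e j))"
      and hr: "group_hom G (tensor_square G) (tensor G (e i))"
      using tensor_hom_left tensor_hom_right e by unfold_locales auto
    have "tensor G (e i) (e j) [^]\<^bsub>tensor_square G\<^esub> n i = \<one>\<^bsub>tensor_square G\<^esub>"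
      "tensor G (e i) (e j) [^]\<^bsub>tensor_square G\<^esub> n j = \<one>\<^bsub>tensor_square G\<^esub>"
      using group_hom.hom_nat_pow[OF hl e, of i "n i"] group_hom.hom_nat_pow[OF hr e, of j "n j"]
        group_hom.hom_one[OF hl] group_hom.hom_one[OF hr] by (simp_all add: e_pow)
    then show ?thesis by (simp add: S.pow_eq_id tensor_in_carrier e)
  qed
  have "\<exists>\<psi>\<in>hom ?T (tensor_square G).
      \<forall>k\<in>I \<times> I. \<psi> (cyclic_unit (I \<times> I) ?m k) = (\<lambda>(i, j). tensor G (e i) (e j)) k"
    using I by (intro S.cyclic_prod_lift) (auto simp: tensor_in_carrier e tensor_pow)
  then obtain \<psi> where \<psi>: "\<psi> \<in> hom ?T (tensor_square G)"
    and \<psi>_unit: "\<And>i j. i \<in> I \<Longrightarrow> j \<in> I \<Longrightarrow>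
      \<psi> (cyclic_unit (I \<times> I) ?m (i, j)) = tensor G (e i) (e j)"
    by auto

  have "\<phi> (\<psi> c) = c" if "c \<in> carrier ?T" for c
  proof -
    have "(\<phi> \<circ> \<psi>) c = id c"
    proof (rule cyclic_prod_hom_eqI[OF T.is_group Group.hom_compose[OF \<psi> \<phi>] _ _ _ that])
      show "id \<in> hom ?T ?T" by (auto simp: hom_def)
    qed (use I in \<open>auto simp: \<psi>_unit \<phi>_tensor \<beta>_e e\<close>)
    then show ?thesis by simp
  qed
  moreover have "\<psi> (\<phi> A) = A" if "A \<in> carrier (tensor_square G)" for A
  proof -
    note \<phi>\<psi> = Group.hom_compose[OF \<phi> \<psi>]
    have id: "id \<in> hom (tensor_square G) (tensor_square G)" by (auto simp: hom_def)
    \<comment> \<open>Linearity is used one slot at a time: agreement of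
      \<open>\<psi> \<circ> \<phi>\<close> with the identity spreads from pairs of generators to an
      arbitrary second factor, then to an arbitrary first one.\<close>
    have left: "(\<lambda>g. F (tensor G g h)) \<in> hom G (tensor_square G)"
      if "F \<in> hom (tensor_square G) (tensor_square G)" "h \<in> carrier G" for F h
      using Group.hom_compose[OF tensor_hom_left that(1)] that(2) by (simp add: comp_def)
    have right: "(\<lambda>h. F (tensor G g h)) \<in> hom G (tensor_square G)"
      if "F \<in> hom (tensor_square G) (tensor_square G)" "g \<in> carrier G" for F g
      using Group.hom_compose[OF tensor_hom_right that(1)] that(2) by (simp add: comp_def)
    have ee: "(\<psi> \<circ> \<phi>) (tensor G (e i) (e j)) = id (tensor G (e i) (e j))"
      if "i \<in> I" "j \<in> I" for i j
      using that by (simp add: \<phi>_tensor \<beta>_e e \<psi>_unit)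
    have eh: "(\<psi> \<circ> \<phi>) (tensor G (e i) h) = id (tensor G (e i) h)"
      if "i \<in> I" "h \<in> carrier G" for i h
      by (rule G_hom_eqI[OF S.is_group right[OF \<phi>\<psi> e] right[OF id e] ee that(2)]) (rule that(1))
    have gh: "(\<psi> \<circ> \<phi>) (tensor G g h) = id (tensor G g h)"
      if "g \<in> carrier G" "h \<in> carrier G" for g h
      by (rule G_hom_eqI[OF S.is_group left[OF \<phi>\<psi> that(2)] left[OF id that(2)] eh that(1)])
        (use that in auto)
    have "(\<psi> \<circ> \<phi>) A = id A"
      by (rule tensor_square_hom_eqI[OF S.is_group \<phi>\<psi> id gh that])
    then show ?thesis by simp
  qed
  ultimately have "group_isomorphisms (tensor_square G) ?T \<phi> \<psi>"
    using \<phi> \<psi> by (auto simp: group_isomorphisms_def)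
  then show ?thesis by (rule is_isoI[OF group_isomorphisms_imp_iso])
qed


section \<open>Lists of cyclic factors\<close>

text \<open>With lists, direct products become concatenations, and equality of multisets expresses
  equality up to the order of the factors.\<close>

definition cyclic_sum :: "nat list \<Rightarrow> (nat \<Rightarrow> int) monoid" where
  "cyclic_sum ns = cyclic_prod {..<length ns} (\<lambda>i. ns ! i)"

text \<open>Precomposition with \<open>f\<close> is the isomorphism, and precomposition with the
  inverse of \<open>f\<close> undoes it.\<close>

lemma cyclic_prod_reindex:
  assumes f: "bij_betw f I J" and n: "\<And>i. i \<in> I \<Longrightarrow> n i = m (f i)"
  shows "cyclic_prod J m \<cong> cyclic_prod I n"
proof (rule is_isoI, rule group_isomorphisms_imp_iso)
  define g where "g = inv_into I f"
  have fI: "f i \<in> J" and gf: "g (f i) = i" if "i \<in> I" for i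
    using f that by (auto simp: bij_betw_def g_def)
  have gJ: "g j \<in> I" and fg: "f (g j) = j" if "j \<in> J" for j
    using f that by (auto simp: bij_betw_def g_def inv_into_into f_inv_into_f)
  have mem: "x (g j) \<in> carrier (integer_mod_group (m j))"
    if "\<forall>i\<in>I. x i \<in> carrier (integer_mod_group (m (f i)))" "j \<in> J" for x j
    using that gJ fg by metis
  show "group_isomorphisms (cyclic_prod J m) (cyclic_prod I n)
      (\<lambda>c. \<lambda>i\<in>I. c (f i)) (\<lambda>c. \<lambda>j\<in>J. c (g j))"
    unfolding group_isomorphisms_def
    by (auto intro!: homI restrict_ext mem simp: carrier_cyclic_prod mult_cyclic_prod fI gf gJ fg n
        PiE_iff extensional_def fun_eq_iff)
qed

lemma cyclic_sum_single: "integer_mod_group n \<cong> cyclic_sum [n]"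
proof (rule is_isoI, rule group_isomorphisms_imp_iso)
  show "group_isomorphisms (integer_mod_group n) (cyclic_sum [n])
      (\<lambda>a. \<lambda>i\<in>{..<length [n]}. a) (\<lambda>c. c 0)"
    unfolding group_isomorphisms_def cyclic_sum_def
    by (auto intro!: homI simp: carrier_cyclic_prod mult_cyclic_prod PiE_iff extensional_def fun_eq_iff)
qed

text \<open>The two tuples are concatenated; the second one is read back with its indices shifted by
  \<open>length xs\<close>.\<close>

lemma cyclic_sum_append: "cyclic_sum xs \<times>\<times> cyclic_sum ys \<cong> cyclic_sum (xs @ ys)"
proof (rule is_isoI, rule group_isomorphisms_imp_iso)
  have mem: "i < length xs \<Longrightarrow> c i \<in> carrier (integer_mod_group (xs ! i))"
    "i < length ys \<Longrightarrow> c (length xs + i) \<in> carrier (integer_mod_group (ys ! i))"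
    if "\<forall>i\<in>{..<length xs + length ys}.
      c i \<in> carrier (integer_mod_group (if i < length xs then xs ! i else ys ! (i - length xs)))"
    for c i
    using bspec[OF that, of i] bspec[OF that, of "length xs + i"] by simp_all
  show "group_isomorphisms (cyclic_sum xs \<times>\<times> cyclic_sum ys) (cyclic_sum (xs @ ys))
      (\<lambda>(c, d). \<lambda>i\<in>{..<length (xs @ ys)}. if i < length xs then c i else d (i - length xs))
      (\<lambda>c. (\<lambda>i\<in>{..<length xs}. c i, \<lambda>i\<in>{..<length ys}. c (length xs + i)))"
    unfolding group_isomorphisms_def cyclic_sum_def
    by (auto intro!: homI restrict_ext mem simp: carrier_cyclic_prod mult_cyclic_prod PiE_iff
        extensional_def fun_eq_iff nth_append)
qed

lemma cyclic_sum_DirProd: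
  assumes "group G" "group H" "G \<cong> cyclic_sum xs" "H \<cong> cyclic_sum ys"
  shows "G \<times>\<times> H \<cong> cyclic_sum (xs @ ys)"
  using group.DirProd_iso_trans[OF assms(1,3,4)] cyclic_sum_append iso_trans by blast

text \<open>Finite support is automatic over \<open>{..<k}\<close>, so direct sum and direct product
  have the same elements and the identity map works.\<close>

lemma copies_iso_cyclic_sum: "copies k (integer_mod_group n) \<cong> cyclic_sum (replicate k n)"
proof (rule is_isoI, rule group_isomorphisms_imp_iso)
  show "group_isomorphisms (copies k (integer_mod_group n)) (cyclic_sum (replicate k n)) id id"
    unfolding group_isomorphisms_def cyclic_sum_def copies_def
    by (auto intro!: homI restrict_ext simp: carrier_cyclic_prod mult_cyclic_prod carrier_sum_group
        PiE_iff extensional_def)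
qed

lemma group_copies: "group A \<Longrightarrow> group (copies k A)"
  by (simp add: copies_def)

text \<open>Only the multiset of orders matters. With \<open>I\<close> listed without repetition as
  \<open>xs\<close>, a permutation \<open>p\<close> rearranges the orders along \<open>xs\<close>
  into \<open>ns\<close>, and \<open>(!) xs \<circ> p\<close> is the reindexing bijection.\<close>

lemma cyclic_prod_iso_cyclic_sum:
  assumes "finite I" "image_mset n (mset_set I) = mset ns"
  shows "cyclic_prod I n \<cong> cyclic_sum ns"
proof -
  obtain xs where xs: "set xs = I" "distinct xs"
    using finite_distinct_list[OF assms(1)] by blast
  have "mset ns = mset (map n xs)"
    using assms(2) xs by (simp flip: mset_set_set)
  then obtain p where p: "p permutes {..<length (map n xs)}" "permute_list p (map n xs) = ns"
    by (rule mset_eq_permutation)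
  have len: "length ns = length xs" using p(2) by auto
  have "bij_betw ((!) xs \<circ> p) {..<length ns} I"
    using bij_betw_trans[OF permutes_imp_bij[OF p(1)]] bij_betw_nth[OF xs(2), of "{..<length xs}" I]
      xs(1) len by simp
  moreover have "ns ! i = n (((!) xs \<circ> p) i)" if "i \<in> {..<length ns}" for i
  proof -
    have "p i < length xs" using permutes_in_image[OF p(1), of i] that len by simp
    moreover have "ns ! i = map n xs ! p i"
      using permute_list_nth[OF p(1), of i] that len by (simp add: p(2))
    ultimately show ?thesis by simp
  qed
  ultimately show ?thesis unfolding cyclic_sum_def by (rule cyclic_prod_reindex)
qed

text \<open>This reduces each case of the theorem to one multiset identity, between the gcds of all
  ordered pairs of entries of \<open>ns\<close> and the orders of the factors of
  \<open>K\<close>.\<close>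

lemma J2_iso_cyclic_sum:
  assumes "comm_group G" "group K" and G: "G \<cong> cyclic_sum ns" and K: "K \<cong> cyclic_sum ms"
    and ms: "mset (map (\<lambda>(a, b). gcd a b) (List.product ns ns)) = mset ms"
  shows "J2 G \<cong> K"
proof -
  interpret G: comm_group G by fact
  let ?I = "{..<length ns}"
  let ?m = "\<lambda>(i, j). gcd (ns ! i) (ns ! j)"
  let ?L = "[0..<length ns]"
  \<comment> \<open>Pairs of positions are replaced by pairs of entries, a form that can be
    evaluated on an explicit list.\<close>
  have "image_mset ?m (mset_set (?I \<times> ?I)) = mset (map ?m (List.product ?L ?L))"
    using mset_set_set[OF distinct_product[of ?L ?L]]
    by (simp add: lessThan_atLeast0)
  also have "map ?m (List.product ?L ?L) =
      map (\<lambda>(a, b). gcd a b) (List.product (map ((!) ns) ?L) (map ((!) ns) ?L))"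
    by (simp add: product_concat_map map_concat comp_def)
  finally have "image_mset ?m (mset_set (?I \<times> ?I)) = mset ms"
    using ms by (simp add: map_nth)
  then have "cyclic_prod (?I \<times> ?I) ?m \<cong> cyclic_sum ms"
    by (intro cyclic_prod_iso_cyclic_sum) auto
  note this group.iso_sym[OF assms(2) K]
  moreover have "J2 G \<cong> cyclic_prod (?I \<times> ?I) ?m"
    using G.tensor_square_iso_cyclic_prod[of ?I "(!) ns"] G
    by (simp add: G.J2_eq_tensor_square cyclic_sum_def)
  ultimately show ?thesis by (metis iso_trans)
qed

section \<open>Evaluation for the seven types of groups of order \<open>p ^ 5\<close>\<close>

theorem lemma3p2:
  fixes p :: nat and G :: "('a, 'm) monoid_scheme"
  assumes "Factorial_Ring.prime p" and "p > 3"
    and "comm_group G" and "order G dvd p ^ 5"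
  shows
    "(G \<cong> integer_mod_group (p ^ 5) \<longrightarrow>
        J2 G \<cong> integer_mod_group (p ^ 5)) \<and>
     (G \<cong> integer_mod_group (p ^ 3) \<times>\<times> integer_mod_group (p ^ 2) \<longrightarrow>
        J2 G \<cong> integer_mod_group (p ^ 3) \<times>\<times> copies 3 (integer_mod_group (p ^ 2))) \<and>
     (G \<cong> integer_mod_group (p ^ 4) \<times>\<times> integer_mod_group p \<longrightarrow>
        J2 G \<cong> integer_mod_group (p ^ 4) \<times>\<times> copies 3 (integer_mod_group p)) \<and>
     (G \<cong> integer_mod_group (p ^ 2) \<times>\<times> integer_mod_group (p ^ 2) \<times>\<times> integer_mod_group p \<longrightarrow>
        J2 G \<cong> copies 4 (integer_mod_group (p ^ 2)) \<times>\<times> copies 5 (integer_mod_group p)) \<and>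
     (G \<cong> integer_mod_group (p ^ 3) \<times>\<times> integer_mod_group p \<times>\<times> integer_mod_group p \<longrightarrow>
        J2 G \<cong> integer_mod_group (p ^ 3) \<times>\<times> copies 8 (integer_mod_group p)) \<and>
     (G \<cong> integer_mod_group (p ^ 2) \<times>\<times> integer_mod_group p \<times>\<times> integer_mod_group p
             \<times>\<times> integer_mod_group p \<longrightarrow>
        J2 G \<cong> integer_mod_group (p ^ 2) \<times>\<times> copies 15 (integer_mod_group p)) \<and>
     (G \<cong> copies 5 (integer_mod_group p) \<longrightarrow>
        J2 G \<cong> copies 25 (integer_mod_group p))"
proof -
  note groups = group_integer_mod_group DirProd_group group_copies
  note isos = cyclic_sum_DirProd cyclic_sum_single copies_iso_cyclic_sum groups
  have gcds: "gcd (p ^ a) (p ^ b) = p ^ min a b" for a b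
    by (cases "a \<le> b")
      (simp_all add: gcd_proj1_if_dvd_nat gcd_proj2_if_dvd_nat le_imp_power_dvd min_def)
  \<comment> \<open>A factor of order \<open>p\<close> is written without an exponent, so the rule
    is also needed with a bare \<open>p\<close> on either side.\<close>
  have gcds': "gcd p (p ^ b) = p ^ min 1 b" "gcd (p ^ b) p = p ^ min b 1" for b
    using gcds[of 1 b] gcds[of b 1] by simp_all
  note J2 = J2_iso_cyclic_sum[OF assms(3)]
  show ?thesis
    \<comment> \<open>The lists \<open>ns\<close> and \<open>ms\<close> stay schematic and are read
      off from the two products by unification; \<open>simp\<close> then expands the
      \<open>replicate\<close> counts, computes the gcds and compares multisets. For example,
      exponents 3, 2 yield 3, 2, 2, 2.\<close>
    by (intro conjI impI;
        (rule J2, ((rule groups)+)[1], erule iso_trans, ((rule isos)+)[1], ((rule isos)+)[1],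
          simp add: gcds gcds' eval_nat_numeral))
qed

end
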